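(* Let $m, n$ be integers with $0 < m < n$, and let $E \subset \mathbb{R}^{n}$ be an $m$-rectifiable set which is not $m$-flat. Then there exists $x \in E$ such that $\mathcal{H}^m(\pi_x(E \setminus \{x\})) > 0$. In particular, the set of directions $$\mathcal{D}(E) := \left\{\frac{y-x}{|y-x|} : x, y \in E,\ y \neq x\right\}$$ satisfies $\mathcal{H}^m(\mathcal{D}(E)) > 0$.
   Context: $\mathcal{H}^m$ denotes $m$-dimensional Hausdorff (outer) measure on $\mathbb{R}^n$, and $\mathbb{S}^{n-1}$ is the unit sphere of $\mathbb{R}^n$. For $x \in \mathbb{R}^n$, the radial projection $\pi_x \colon \mathbb{R}^n \setminus \{x\} \to \mathbb{S}^{n-1}$ is $\pi_x(y) = (y-x)/|y-x|$. A $C^1$-embedding $f \colon \mathbb{R}^m \to \mathbb{R}^n$ is a continuously differentiable map that is a homeomorphism onto its image. An $\mathcal{H}^m$-measurable set $E \subset \mathbb{R}^n$ is called $m$-rectifiable if $\mathcal{H}^m(E) > 0$ and there are countably many $C^1$-embeddings $f_i \colon \mathbb{R}^m \to \mathbb{R}^n$ such that $\mathcal{H}^m\big(E \setminus \bigcup_i f_i(\mathbb{R}^m)\big) = 0$. (Positivity of the measure is part of the definition; finiteness of $\mathcal{H}^m(E)$ is not required.) An $m$-plane is an $m$-dimensional affine subspace of $\mathbb{R}^n$. A set $A \subset \mathbb{R}^n$ is $m$-flat if there is an $m$-plane $T$ with $A \subset T$. *)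

theory Defs
  imports "HOL-Analysis.Analysis"
begin

text \<open>
  The size-\<open>\<delta>\<close> pre-measure and the Hausdorff outer measure, normalised so that it
  agrees with Lebesgue measure when \<open>m\<close> is the dimension of the Euclidean space. The library's
  diameter is real-valued and meaningless on unbounded sets, hence the explicit boundedness
  condition; the case distinction makes empty covering sets contribute nothing also for
  \<open>m = 0\<close>, where \<open>0 ^ 0 = 1\<close>.
\<close>

definition hausdorff_premeasure :: "nat \<Rightarrow> real \<Rightarrow> 'a::metric_space set \<Rightarrow> ennreal" where
  "hausdorff_premeasure m \<delta> A =
     (INF C \<in> {C :: nat \<Rightarrow> 'a set. A \<subseteq> (\<Union>i. C i) \<and> (\<forall>i. bounded (C i) \<and> diameter (C i) \<le> \<delta>)}.
        \<Sum>i. if C i = {} then 0 else ennreal (unit_ball_vol (real m) * (diameter (C i) / 2) ^ m))"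

definition hausdorff_measure :: "nat \<Rightarrow> 'a::metric_space set \<Rightarrow> ennreal" where
  "hausdorff_measure m A = (SUP \<delta> \<in> {0<..}. hausdorff_premeasure m \<delta> A)"

text \<open>Measurability in the sense of Caratheodory.\<close>

definition hausdorff_measurable :: "nat \<Rightarrow> 'a::metric_space set \<Rightarrow> bool" where
  "hausdorff_measurable m E \<longleftrightarrow> E \<in> lambda_system UNIV UNIV (hausdorff_measure m)"

text \<open>No immersion condition: injectivity of the derivative is not required.\<close>

definition C1_embedding :: "('a::euclidean_space \<Rightarrow> 'b::euclidean_space) \<Rightarrow> bool" where
  "C1_embedding f \<longleftrightarrow>
     (\<exists>f' :: 'a \<Rightarrow> 'a \<Rightarrow>\<^sub>L 'b.
        (\<forall>x. (f has_derivative blinfun_apply (f' x)) (at x)) \<and> continuous_on UNIV f') \<and>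
     (\<exists>g. homeomorphism UNIV (range f) f g)"

text \<open>The type argument is the parameter space; its dimension is the \<open>m\<close> of \<open>m\<close>-rectifiability.\<close>

definition rectifiable :: "'a::euclidean_space itself \<Rightarrow> 'b::euclidean_space set \<Rightarrow> bool" where
  "rectifiable TYPE('a) E \<longleftrightarrow>
     hausdorff_measurable DIM('a) E \<and>
     hausdorff_measure DIM('a) E > 0 \<and>
     (\<exists>F :: ('a \<Rightarrow> 'b) set. countable F \<and> (\<forall>f\<in>F. C1_embedding f) \<and>
        hausdorff_measure DIM('a) (E - (\<Union>f\<in>F. range f)) = 0)"

definition flat :: "nat \<Rightarrow> 'a::euclidean_space set \<Rightarrow> bool" where
  "flat m A \<longleftrightarrow> (\<exists>T. affine T \<and> aff_dim T = int m \<and> A \<subseteq> T)"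

definition radial_projection :: "'a::real_normed_vector \<Rightarrow> 'a \<Rightarrow> 'a" where
  "radial_projection x y = (y - x) /\<^sub>R norm (y - x)"

definition directions :: "'a::real_normed_vector set \<Rightarrow> 'a set" where
  "directions E = {(y - x) /\<^sub>R norm (y - x) | x y. x \<in> E \<and> y \<in> E \<and> y \<noteq> x}"

end

theory Submission
  imports Defs
begin

text \<open>
  Pick an embedding \<open>f\<close> whose image meets \<open>E\<close> in positive measure. Since the critical values of a
  \<open>C\<^sup>1\<close> map are \<open>H\<^sup>m\<close>-null (a Sard-type estimate) and \<open>\<real>\<^sup>m\<close> is a Lindelof space, there is a point \<open>a\<close> at
  which the derivative of \<open>f\<close> is injective and near which \<open>f\<close> still covers a non-null part of \<open>E\<close>.
  If \<open>x \<in> E\<close> lies outside the tangent plane of \<open>f\<close> at \<open>f a\<close>, then \<open>\<pi>\<^sub>x \<circ> f\<close> is an immersion at \<open>a\<close>, so near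
  \<open>a\<close> the map \<open>f\<close> factors through \<open>\<pi>\<^sub>x \<circ> f\<close> by a Lipschitz map, and the radial projection from \<open>x\<close> of
  that part of \<open>E\<close> cannot be null. Such an \<open>x\<close> exists because \<open>E\<close> is not contained in that plane.
\<close>

section \<open>Hausdorff content and its null sets\<close>

text \<open>
  Without a bound on the diameters of the covering sets the outer measure is easier to handle, and
  for \<open>0 < m\<close> it has the same null sets as \<open>hausdorff_measure m\<close>.
\<close>

definition hausdorff_content :: "nat \<Rightarrow> 'a::metric_space set \<Rightarrow> ennreal" where
  "hausdorff_content m A =
     (INF C \<in> {C :: nat \<Rightarrow> 'a set. A \<subseteq> (\<Union>i. C i) \<and> (\<forall>i. bounded (C i))}.
        \<Sum>i. ennreal (diameter (C i) ^ m))"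

lemma hausdorff_content_le:
  assumes "A \<subseteq> (\<Union>i. C i)" "\<And>i. bounded (C i)"
  shows "hausdorff_content m A \<le> (\<Sum>i. ennreal (diameter (C i) ^ m))"
  unfolding hausdorff_content_def by (rule INF_lower) (use assms in auto)

lemma hausdorff_content_mono: "A \<subseteq> B \<Longrightarrow> hausdorff_content m A \<le> hausdorff_content m B"
  unfolding hausdorff_content_def by (rule INF_superset_mono) auto

lemma hausdorff_content_close:
  assumes "hausdorff_content m A < e"
  obtains C :: "nat \<Rightarrow> 'a::metric_space set" where "A \<subseteq> (\<Union>i. C i)" "\<And>i. bounded (C i)"
    "(\<Sum>i. ennreal (diameter (C i) ^ m)) < e"
  using assms unfolding hausdorff_content_def INF_less_iff by auto

text \<open>The cover is \<open>A\<close> padded with empty sets, each contributing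
  \<open>0 ^ m\<close>; this is 0 because \<open>0 < m\<close>.\<close>

lemma hausdorff_content_le_diameter:
  assumes "bounded A" "0 < m"
  shows "hausdorff_content m A \<le> ennreal (diameter A ^ m)"
proof -
  have "hausdorff_content m A
      \<le> (\<Sum>i. ennreal (diameter (if i = (0::nat) then A else {}) ^ m))"
    by (rule hausdorff_content_le) (use assms in auto)
  also have "\<dots> = (\<Sum>i\<in>{0::nat}. ennreal (diameter (if i = (0::nat) then A else {}) ^ m))"
    by (rule suminf_finite) (use assms in auto)
  finally show ?thesis by simp
qed

lemma hausdorff_content_empty [simp]: "0 < m \<Longrightarrow> hausdorff_content m {} = 0"
  using hausdorff_content_le_diameter[of "{}" m] by (simp add: zero_power)

lemma hausdorff_content_countably_subadditive:
  fixes A :: "nat \<Rightarrow> 'a::metric_space set"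
  shows "hausdorff_content m (\<Union>i. A i) \<le> (\<Sum>i. hausdorff_content m (A i))"
proof (rule ennreal_le_epsilon)
  let ?O = "hausdorff_content m"
  fix e :: real assume "0 < e" and fin: "(\<Sum>i. ?O (A i)) < top"
  \<comment> \<open>By \<open>fin\<close> every term is finite, so a positive slack gives a strict
    inequality; the slacks add up to \<open>e\<close>.\<close>
  then have *: "?O (A n) < ?O (A n) + e * (1/2) ^ Suc n" for n
    by (auto simp add: less_top dest!: ennreal_suminf_lessD)
  have "\<exists>C. A n \<subseteq> (\<Union>i. C i) \<and> (\<forall>i. bounded (C i)) \<and>
      (\<Sum>i. ennreal (diameter (C i) ^ m)) \<le> ?O (A n) + e * (1/2) ^ Suc n" for n
    using hausdorff_content_close[OF *] by (metis less_imp_le)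
  then obtain B :: "nat \<Rightarrow> nat \<Rightarrow> 'a set" where B: "\<And>n. A n \<subseteq> (\<Union>i. B n i)" "\<And>n i. bounded (B n i)"
    "\<And>n. (\<Sum>i. ennreal (diameter (B n i) ^ m)) \<le> ?O (A n) + e * (1/2) ^ Suc n"
    by metis
  define C where "C = case_prod B \<circ> prod_decode"
  have sub: "(\<Union>i. A i) \<subseteq> (\<Union>i. C i)"
    using B(1) by (auto simp: C_def subset_eq) (metis prod.case prod_encode_inverse)
  have bdd: "bounded (C i)" for i
    by (simp add: C_def split_beta B(2))
  have "?O (\<Union>i. A i) \<le> (\<Sum>i. ennreal (diameter (C i) ^ m))"
    by (rule hausdorff_content_le[OF sub bdd])
  also have "\<dots> = (\<Sum>i. (\<lambda>(n, i). ennreal (diameter (B n i) ^ m)) (prod_decode i))"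
    by (simp add: C_def split_beta)
  also have "\<dots> = (\<Sum>n. \<Sum>i. ennreal (diameter (B n i) ^ m))"
    by (rule suminf_ennreal_2dimen) simp
  also have "\<dots> \<le> (\<Sum>n. ?O (A n) + e * (1/2) ^ Suc n)"
    by (intro suminf_le allI B(3)) auto
  also have "\<dots> = (\<Sum>n. ?O (A n)) + (\<Sum>n. ennreal e * ennreal ((1/2) ^ Suc n))"
    using \<open>0 < e\<close> by (subst suminf_add[symmetric])
                     (auto simp del: ennreal_suminf_cmult simp add: ennreal_mult[symmetric])
  also have "\<dots> = (\<Sum>n. ?O (A n)) + e"
    unfolding ennreal_suminf_cmult
    by (subst suminf_ennreal_eq[OF zero_le_power power_half_series]) auto
  finally show "?O (\<Union>i. A i) \<le> (\<Sum>n. ?O (A n)) + e" .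
qed

lemma hausdorff_content_Un:
  assumes "0 < m"
  shows "hausdorff_content m (A \<union> B) \<le> hausdorff_content m A + hausdorff_content m B"
proof -
  define D where "D = (\<lambda>i::nat. if i = 0 then A else if i = 1 then B else {})"
  have "A \<union> B = (\<Union>i. D i)"
  proof
    show "A \<union> B \<subseteq> (\<Union>i. D i)"
      using UN_upper[of 0 UNIV D] UN_upper[of 1 UNIV D] by (auto simp: D_def)
  qed (auto simp: D_def split: if_splits)
  then have "hausdorff_content m (A \<union> B) \<le> (\<Sum>i. hausdorff_content m (D i))"
    using hausdorff_content_countably_subadditive[of m D] by simp
  also have "\<dots> = (\<Sum>i\<in>{0, 1}. hausdorff_content m (D i))"
    by (rule suminf_finite) (use assms in \<open>auto simp: D_def\<close>)
  finally show ?thesis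
    by (simp add: D_def)
qed

lemma hausdorff_content_finite_UN:
  assumes "0 < m" "finite I"
  shows "hausdorff_content m (\<Union>i\<in>I. A i) \<le> (\<Sum>i\<in>I. hausdorff_content m (A i))"
  using assms(2)
proof induction
  case (insert i I)
  have "hausdorff_content m (A i \<union> (\<Union>i\<in>I. A i))
      \<le> hausdorff_content m (A i) + hausdorff_content m (\<Union>i\<in>I. A i)"
    by (rule hausdorff_content_Un[OF assms(1)])
  also have "\<dots> \<le> hausdorff_content m (A i) + (\<Sum>i\<in>I. hausdorff_content m (A i))"
    by (intro add_left_mono insert.IH)
  finally show ?case using insert.hyps by simp
qed (use assms in simp)

lemma hausdorff_content_UN_null:
  assumes "0 < m" "countable I" "\<And>i. i \<in> I \<Longrightarrow> hausdorff_content m (A i) = 0"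
  shows "hausdorff_content m (\<Union>i\<in>I. A i) = 0"
proof (cases "I = {}")
  case False
  then have "hausdorff_content m (\<Union>i\<in>I. A i) = hausdorff_content m (\<Union>n. A (from_nat_into I n))"
    using range_from_nat_into[OF False assms(2)] by (metis image_image)
  also have "\<dots> \<le> (\<Sum>n. hausdorff_content m (A (from_nat_into I n)))"
    by (rule hausdorff_content_countably_subadditive)
  also have "\<dots> = 0"
    using assms(3) from_nat_into[OF False] by simp
  finally show ?thesis by simp
qed (use assms in simp)

lemma hausdorff_content_null_mono:
  "hausdorff_content m B = 0 \<Longrightarrow> A \<subseteq> B \<Longrightarrow> hausdorff_content m A = 0"
  using hausdorff_content_mono[of A B m] by simp

text \<open>On \<open>S\<close> the map \<open>f\<close> factors through \<open>g\<close> by a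
  \<open>K\<close>-Lipschitz map, and such a map multiplies the content by at most
  \<open>K ^ m\<close>. The domination hypothesis expresses this without naming the factor. In the
  application \<open>g\<close> is \<open>f\<close> followed by a radial projection.\<close>

lemma hausdorff_content_null_dominated_image:
  assumes m: "0 < m" and K: "0 \<le> K"
    and dom: "\<And>p q. p \<in> S \<Longrightarrow> q \<in> S \<Longrightarrow> dist (f p) (f q) \<le> K * dist (g p) (g q)"
    and null: "hausdorff_content m (g ` S) = 0"
  shows "hausdorff_content m (f ` S) = 0"
proof -
  have "hausdorff_content m (f ` S) \<le> ennreal (K ^ m) * ennreal e" if e: "0 < e" for e
  proof -
    obtain C where C: "g ` S \<subseteq> (\<Union>i. C i)" "\<And>i. bounded (C i)"
      "(\<Sum>i. ennreal (diameter (C i) ^ m)) < ennreal e"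
      by (rule hausdorff_content_close[of m "g ` S" "ennreal e"]) (use null e in auto)
    define C' where "C' i = f ` {p \<in> S. g p \<in> C i}" for i
    have d: "dist u v \<le> K * diameter (C i)" if "u \<in> C' i" "v \<in> C' i" for i u v
    proof -
      obtain p q where pq: "u = f p" "v = f q" "p \<in> S" "q \<in> S" "g p \<in> C i" "g q \<in> C i"
        using \<open>u \<in> C' i\<close> \<open>v \<in> C' i\<close> by (auto simp: C'_def)
      have "dist u v \<le> K * dist (g p) (g q)"
        using pq dom by auto
      also have "\<dots> \<le> K * diameter (C i)"
        by (intro mult_left_mono K diameter_bounded_bound C(2) pq)
      finally show ?thesis .
    qed
    have bdd: "bounded (C' i)" for i
      unfolding bounded_two_points using d by blast
    have diam: "diameter (C' i) \<le> K * diameter (C i)" for i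
    \<comment> \<open>The empty set is treated apart because \<open>diameter\<close> is a supremum
      only for nonempty sets.\<close>
    proof (cases "C' i = {}")
      case True
      then show ?thesis using K diameter_ge_0[OF C(2)] by simp
    next
      case False
      then have "diameter (C' i) = (SUP (u, v) \<in> C' i \<times> C' i. dist u v)"
        by (simp add: diameter_def)
      also have "\<dots> \<le> K * diameter (C i)"
        by (rule cSUP_least) (use False d in auto)
      finally show ?thesis .
    qed
    have "f ` S \<subseteq> (\<Union>i. C' i)"
      using C(1) by (fastforce simp: C'_def)
    then have "hausdorff_content m (f ` S) \<le> (\<Sum>i. ennreal (diameter (C' i) ^ m))"
      by (rule hausdorff_content_le[OF _ bdd])
    also have "\<dots> \<le> (\<Sum>i. ennreal (K ^ m) * ennreal (diameter (C i) ^ m))"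
    proof (intro suminf_le allI)
      fix i
      have "diameter (C' i) ^ m \<le> (K * diameter (C i)) ^ m"
        by (intro power_mono diam diameter_ge_0 bdd)
      then show "ennreal (diameter (C' i) ^ m) \<le> ennreal (K ^ m) * ennreal (diameter (C i) ^ m)"
        using K diameter_ge_0[OF C(2)]
        by (simp add: power_mult_distrib ennreal_mult[symmetric] ennreal_leI)
    qed auto
    also have "\<dots> = ennreal (K ^ m) * (\<Sum>i. ennreal (diameter (C i) ^ m))"
      by simp
    also have "\<dots> \<le> ennreal (K ^ m) * ennreal e"
      using C(3) by (intro mult_left_mono) auto
    finally show ?thesis .
  qed note le = this
  have "hausdorff_content m (f ` S) \<le> 0"
  proof (rule ennreal_le_epsilon)
    fix e :: real assume e: "0 < e"
    \<comment> \<open>Dividing by \<open>K ^ m + 1\<close> instead of \<open>K ^ m\<close> also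
      covers \<open>K = 0\<close>.\<close>
    have pos: "0 < K ^ m + 1"
      using K by (simp add: add_nonneg_pos)
    have le_e: "K ^ m * (e / (K ^ m + 1)) \<le> e"
      using pos e by (simp add: field_simps)
    have "hausdorff_content m (f ` S) \<le> ennreal (K ^ m) * ennreal (e / (K ^ m + 1))"
      using e pos by (intro le) simp
    also have "\<dots> \<le> ennreal e"
      using le_e e K pos by (subst ennreal_mult[symmetric]) (auto intro: ennreal_leI)
    finally show "hausdorff_content m (f ` S) \<le> 0 + ennreal e" by simp
  qed
  then show ?thesis by simp
qed

text \<open>A cover whose sum is below \<open>\<delta> ^ m\<close> consists of sets of diameter at
  most \<delta>, so for null sets the size restriction costs nothing. What remains is the
  normalising factor \<open>c\<close>.\<close>

lemma hausdorff_measure_eq_0_iff: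
  fixes A :: "'a::metric_space set"
  assumes m: "0 < m"
  shows "hausdorff_measure m A = 0 \<longleftrightarrow> hausdorff_content m A = 0"
proof -
  define c where "c = unit_ball_vol (real m) / 2 ^ m"
  have c: "c > 0"
    by (simp add: c_def unit_ball_vol_pos)
  \<comment> \<open>For \<open>C = {}\<close> the right-hand side is a multiple of
    \<open>0 ^ m\<close>, which vanishes since \<open>0 < m\<close>.\<close>
  have term_eq: "(if C = {} then 0 else ennreal (unit_ball_vol (real m) * (diameter C / 2) ^ m))
      = ennreal c * ennreal (diameter C ^ m)" if "bounded C" for C :: "'a set"
    using m c diameter_ge_0[OF that] 
    by (auto simp: ennreal_mult[symmetric] c_def power_divide)
  have pre_ge: "ennreal c * hausdorff_content m A \<le> hausdorff_premeasure m \<delta> A" for \<delta>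
    unfolding hausdorff_premeasure_def
  proof (safe intro!: INF_greatest)
    fix C :: "nat \<Rightarrow> 'a set"
    assume C: "A \<subseteq> (\<Union>i. C i)" "\<forall>i. bounded (C i) \<and> diameter (C i) \<le> \<delta>"
    have "ennreal c * hausdorff_content m A \<le> ennreal c * (\<Sum>i. ennreal (diameter (C i) ^ m))"
      using C by (intro mult_left_mono hausdorff_content_le) auto
    also have "\<dots> = (\<Sum>i. if C i = {} then 0
        else ennreal (unit_ball_vol (real m) * (diameter (C i) / 2) ^ m))"
      using C(2) by (simp add: term_eq)
    finally show "ennreal c * hausdorff_content m A \<le> \<dots>" .
  qed
  have pre_0: "hausdorff_premeasure m \<delta> A = 0" if null: "hausdorff_content m A = 0" and "0 < \<delta>" for \<delta>
  proof -
    have "hausdorff_premeasure m \<delta> A \<le> 0"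
    proof (rule ennreal_le_epsilon)
      fix e :: real assume e: "0 < e"
      \<comment> \<open>The first bound keeps the normalised sum below \<open>e\<close>, the second
        forces every diameter to be at most \<delta>.\<close>
      define e' where "e' = min (e / c) (\<delta> ^ m)"
      have e': "e' > 0" "c * e' \<le> e" "e' \<le> \<delta> ^ m"
        using e c \<open>0 < \<delta>\<close> by (auto simp: e'_def min_def field_simps)
      obtain C where C: "A \<subseteq> (\<Union>i. C i)" "\<And>i. bounded (C i)"
        "(\<Sum>i. ennreal (diameter (C i) ^ m)) < ennreal e'"
        by (rule hausdorff_content_close[of m A "ennreal e'"]) (use null e' in auto)
      have diam: "diameter (C i) \<le> \<delta>" for i
      proof -
        have "ennreal (diameter (C i) ^ m) \<le> (\<Sum>i. ennreal (diameter (C i) ^ m))"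
          using sum_le_suminf[of "\<lambda>i. ennreal (diameter (C i) ^ m)" "{i}"] by simp
        then have "diameter (C i) ^ m \<le> e'"
          using C(3) e' by (metis ennreal_le_iff less_imp_le order.trans)
        then have "diameter (C i) ^ m \<le> \<delta> ^ m"
          using e' by simp
        then show ?thesis
          using power_mono_iff diameter_ge_0[OF C(2)] \<open>0 < \<delta>\<close> m by (metis less_imp_le)
      qed
      have "hausdorff_premeasure m \<delta> A \<le> (\<Sum>i. if C i = {} then 0
          else ennreal (unit_ball_vol (real m) * (diameter (C i) / 2) ^ m))"
        unfolding hausdorff_premeasure_def by (rule INF_lower) (use C diam in auto)
      also have "\<dots> = ennreal c * (\<Sum>i. ennreal (diameter (C i) ^ m))"
        using C(2) by (simp add: term_eq)
      also have "\<dots> \<le> ennreal c * ennreal e'"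
        using C(3) by (intro mult_left_mono) auto
      also have "\<dots> \<le> ennreal e"
        using e' c by (simp add: ennreal_mult[symmetric] ennreal_leI)
      finally show "hausdorff_premeasure m \<delta> A \<le> 0 + ennreal e" by simp
    qed
    then show ?thesis by simp
  qed
  show ?thesis
  proof
    assume "hausdorff_measure m A = 0"
    then have "hausdorff_premeasure m 1 A \<le> 0"
      unfolding hausdorff_measure_def by (metis SUP_upper greaterThan_iff zero_less_one)
    then have "ennreal c * hausdorff_content m A \<le> 0"
      using pre_ge order.trans by blast
    then show "hausdorff_content m A = 0"
      using c by simp
  next
    assume "hausdorff_content m A = 0"
    then show "hausdorff_measure m A = 0"
      unfolding hausdorff_measure_def by (simp add: pre_0)
  qed
qed

section \<open>Critical values form a null set\<close>

text \<open>
  A kernel vector \<open>u\<close> of \<open>D\<close>, scaled to have \<open>u \<bullet> i = 1\<close> for its largest coordinate \<open>i\<close>, lets one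
  eliminate the \<open>i\<close>-th coordinate of \<open>S\<close> without changing \<open>D\<close>. Hence order \<open>K\<^sup>m\<^sup>-\<^sup>1\<close> grid cells suffice
  to cover \<open>f ` S\<close> by sets of diameter of order \<open>s / K\<close>.
\<close>

lemma hausdorff_content_image_degenerate:
  fixes f :: "'a::euclidean_space \<Rightarrow> 'b::euclidean_space" and D :: "'a \<Rightarrow> 'b" and K :: nat and L s :: real
  assumes D: "linear D" "\<not> inj D"
    and L: "0 \<le> L" "\<And>w. norm (D w) \<le> L * norm w"
    and K: "0 < K" and s: "0 < s"
    and approx: "\<And>y z. y \<in> S \<Longrightarrow> z \<in> S \<Longrightarrow> norm (f y - f z - D (y - z)) \<le> norm (y - z) / K"
    and side: "\<And>y z b. y \<in> S \<Longrightarrow> z \<in> S \<Longrightarrow> b \<in> Basis \<Longrightarrow> \<bar>(y - z) \<bullet> b\<bar> \<le> s"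
  shows "hausdorff_content DIM('a) (f ` S)
    \<le> ennreal ((5 * DIM('a) * (L + 1) * s) ^ DIM('a) / K)"
proof (cases "S = {}")
  case False
  then obtain x where x: "x \<in> S" by blast
  interpret D: linear D by (rule D)
  obtain v where v: "D v = 0" "v \<noteq> 0"
    using D linear_injective_0 by blast
  have "\<exists>i\<in>Basis. \<forall>j\<in>Basis. \<bar>v \<bullet> j\<bar> \<le> \<bar>v \<bullet> i\<bar>"
  proof -
    have "Max ((\<lambda>j. \<bar>v \<bullet> j\<bar>) ` Basis) \<in> (\<lambda>j. \<bar>v \<bullet> j\<bar>) ` Basis"
      by (rule Max_in) auto
    then obtain i where "i \<in> Basis" "Max ((\<lambda>j. \<bar>v \<bullet> j\<bar>) ` Basis) = \<bar>v \<bullet> i\<bar>"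
      by (rule imageE) blast
    then show ?thesis
      by (metis Max_ge finite_Basis finite_imageI imageI)
  qed
  then obtain i where i: "i \<in> Basis" "\<And>j. j \<in> Basis \<Longrightarrow> \<bar>v \<bullet> j\<bar> \<le> \<bar>v \<bullet> i\<bar>"
    by blast
  have vi: "v \<bullet> i \<noteq> 0"
    using i(2) v(2) euclidean_all_zero_iff[of v] by fastforce
  define u where "u = v /\<^sub>R (v \<bullet> i)"
  have u: "D u = 0" "u \<bullet> i = 1" "\<And>j. j \<in> Basis \<Longrightarrow> \<bar>u \<bullet> j\<bar> \<le> 1"
    using v vi i(2) by (auto simp: u_def D.scale abs_mult divide_simps)
  \<comment> \<open>\<open>t z\<close> is \<open>z - x\<close> moved along \<open>u\<close> into the
    hyperplane where coordinate \<open>i\<close> vanishes; \<open>D\<close> does not see the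
    move.\<close>
  define t where "t z = (z - x) - ((z - x) \<bullet> i) *\<^sub>R u" for z
  \<comment> \<open>Grid cells of mesh \<open>s / K\<close> in the other coordinates. These are at
    most \<open>2 * s\<close> in absolute value, so the indices lie between \<open>- 2 * K\<close>
    and \<open>2 * K\<close>.\<close>
  define \<kappa> where "\<kappa> z = (\<lambda>j\<in>Basis - {i}. \<lfloor>K * (t z \<bullet> j) / s\<rfloor>)" for z
  define I where "I = (Basis - {i}) \<rightarrow>\<^sub>E {- 2 * int K..2 * int K}"
  \<comment> \<open>Bound for the diameter of the image of one cell: the summand with
    \<open>L\<close> comes from \<open>D\<close>, the other from the error of the linear
    approximation.\<close>
  define d where "d = DIM('a) * s * (L + 1) / K"
  have d0: "0 \<le> d"
    using s L by (simp add: d_def)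
  have "finite I"
    unfolding I_def by (intro finite_PiE) auto
  have "\<kappa> z \<in> I" if z: "z \<in> S" for z
    unfolding \<kappa>_def I_def
  proof (rule restrict_PiE_iff[THEN iffD2], intro ballI)
    fix j assume j: "j \<in> Basis - {i}"
    have "\<bar>t z \<bullet> j\<bar> \<le> \<bar>(z - x) \<bullet> j\<bar> + \<bar>(z - x) \<bullet> i\<bar> * \<bar>u \<bullet> j\<bar>"
      unfolding t_def inner_diff_left[of "z - x"] inner_scaleR_left abs_mult[symmetric]
      by (rule abs_triangle_ineq4)
    also have "\<dots> \<le> s + s * 1"
      using side[OF z x] j i(1) u(3) s by (intro add_mono mult_mono) auto
    finally have "\<bar>K * (t z \<bullet> j) / s\<bar> \<le> 2 * K"
      using s K by (simp add: abs_mult divide_simps mult.commute)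
    then have "- (2 * real K) \<le> K * (t z \<bullet> j) / s" "K * (t z \<bullet> j) / s \<le> 2 * real K"
      unfolding abs_le_iff by linarith+
    then show "\<lfloor>K * (t z \<bullet> j) / s\<rfloor> \<in> {- 2 * int K..2 * int K}"
      by (simp add: le_floor_iff floor_le_iff)
  qed
  then have eq: "f ` S = (\<Union>k\<in>I. f ` {z \<in> S. \<kappa> z = k})"
    by auto
  have "hausdorff_content DIM('a) (f ` S)
      \<le> (\<Sum>k\<in>I. hausdorff_content DIM('a) (f ` {z \<in> S. \<kappa> z = k}))"
    by (subst eq) (rule hausdorff_content_finite_UN[OF DIM_positive \<open>finite I\<close>])
  also have "\<dots> \<le> (\<Sum>k\<in>I. ennreal (d ^ DIM('a)))"
  proof (rule sum_mono)
    fix k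
    have close: "norm (f y - f z) \<le> d"
      if "y \<in> {z \<in> S. \<kappa> z = k}" "z \<in> {z \<in> S. \<kappa> z = k}" for y z
    proof -
      have y: "y \<in> S" and z: "z \<in> S" and eq: "\<kappa> y = \<kappa> z" using that by auto
      \<comment> \<open>Coordinate \<open>i\<close> vanishes for both points; in the other
        coordinates equal floors put the points within one mesh width.\<close>
      have tj: "\<bar>(t y - t z) \<bullet> j\<bar> \<le> s / K" if j: "j \<in> Basis" for j
      proof (cases "j = i")
        case True
        then show ?thesis
          using i(1) u(2) s by (simp add: t_def inner_diff_left)
      next
        case False
        then have "\<lfloor>K * (t y \<bullet> j) / s\<rfloor> = \<lfloor>K * (t z \<bullet> j) / s\<rfloor>"
          using fun_cong[OF eq, of j] j by (simp add: \<kappa>_def)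
        then have "\<bar>K * (t y \<bullet> j) / s - K * (t z \<bullet> j) / s\<bar> \<le> 1"
          by linarith
        also have "K * (t y \<bullet> j) / s - K * (t z \<bullet> j) / s = K / s * ((t y - t z) \<bullet> j)"
          by (simp add: inner_diff_left right_diff_distrib diff_divide_distrib)
        finally show ?thesis
          using s K by (simp add: abs_mult field_simps)
      qed
      have "norm (t y - t z) \<le> (\<Sum>j\<in>Basis. \<bar>(t y - t z) \<bullet> j\<bar>)"
        by (rule norm_le_l1)
      also have "\<dots> \<le> DIM('a) * (s / K)"
        using tj by (rule sum_bounded_above)
      finally have nt: "norm (t y - t z) \<le> DIM('a) * (s / K)" .
      have "norm (y - z) \<le> (\<Sum>j\<in>Basis. \<bar>(y - z) \<bullet> j\<bar>)"
        by (rule norm_le_l1)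
      also have "\<dots> \<le> DIM('a) * s"
        using side[OF y z] by (rule sum_bounded_above)
      finally have nyz: "norm (y - z) \<le> DIM('a) * s" .
      have "D (y - z) = D (t y - t z)"
        by (simp add: t_def D.diff D.scale u(1))
      then have "norm (D (y - z)) \<le> L * (DIM('a) * (s / K))"
        using L nt by (metis mult_left_mono order.trans)
      moreover have "norm (f y - f z - D (y - z)) \<le> DIM('a) * s / K"
        using approx[OF y z] nyz K
        by (meson divide_right_mono of_nat_0_le_iff order.trans)
      moreover have "norm (f y - f z) \<le> norm (f y - f z - D (y - z)) + norm (D (y - z))"
        by (metis diff_add_cancel norm_triangle_ineq)
      moreover have "d = L * (DIM('a) * (s / K)) + DIM('a) * s / K"
        using K by (simp add: d_def field_simps)
      ultimately show ?thesis by linarith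
    qed
    let ?X = "f ` {z \<in> S. \<kappa> z = k}"
    have bdd: "bounded ?X"
      unfolding bounded_two_points dist_norm using close by blast
    have "diameter ?X \<le> d"
      using close d0 by (intro diameter_le) auto
    then have "diameter ?X ^ DIM('a) \<le> d ^ DIM('a)"
      by (intro power_mono diameter_ge_0 bdd)
    then show "hausdorff_content DIM('a) ?X \<le> ennreal (d ^ DIM('a))"
      using hausdorff_content_le_diameter[OF bdd DIM_positive[where 'a='a]]
      by (meson ennreal_leI order.trans)
  qed
  also have "\<dots> = ennreal (card I * d ^ DIM('a))"
    using d0 by (simp add: ennreal_mult ennreal_of_nat_eq_real_of_nat)
  also have "\<dots> \<le> ennreal ((5 * DIM('a) * (L + 1) * s) ^ DIM('a) / K)"
  proof (rule ennreal_leI)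
    obtain p where p: "DIM('a) = Suc p"
      using DIM_positive[where 'a='a] by (cases "DIM('a)") auto
    have "nat (4 * int K + 1) = 4 * K + 1" by simp
    then have "card I = (4 * K + 1) ^ p"
      using i(1) p by (simp add: I_def card_PiE)
    also have "\<dots> \<le> (5 * K) ^ p"
      using K by (intro power_mono) auto
    finally have "real (card I) \<le> (5 * real K) ^ p"
      by (metis of_nat_le_iff of_nat_mult of_nat_numeral of_nat_power)
    then have "card I * d ^ DIM('a) \<le> (5 * real K) ^ p * d ^ DIM('a)"
      using d0 by (intro mult_right_mono) auto
    \<comment> \<open>The extra factor 5 completes the power \<open>p\<close> to
      \<open>DIM('a) = Suc p\<close>, leaving one division by \<open>K\<close>. This gain, due to
      the eliminated coordinate, is the point of the lemma.\<close>
    also have "\<dots> \<le> (5 * real K) ^ p * d ^ DIM('a) * 5"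
      using d0 K by simp
    also have "\<dots> = (5 * real K) ^ DIM('a) * d ^ DIM('a) / K"
      using K by (simp add: p)
    also have "\<dots> = (5 * real K * d) ^ DIM('a) / K"
      by (simp only: power_mult_distrib)
    also have "5 * real K * d = 5 * DIM('a) * (L + 1) * s"
      using K by (simp add: d_def)
    finally show "card I * d ^ DIM('a) \<le> (5 * DIM('a) * (L + 1) * s) ^ DIM('a) / K" .
  qed
  finally show ?thesis .
qed simp

text \<open>By uniform continuity of \<open>f'\<close>, a cube splits into cells of side
  \<open>1 / N\<close> on which \<open>f\<close> is linear up to a relative error
  \<open>1 / K\<close>. The order of \<open>N ^ m\<close> cells each contribute order
  \<open>1 / (N ^ m * K)\<close>, so the total is at most \<open>c / K\<close> with \<open>c\<close>
  independent of \<open>K\<close>. Let \<open>K\<close> grow and exhaust the space by cubes.\<close>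

lemma hausdorff_content_degenerate_values_null:
  fixes f :: "'a::euclidean_space \<Rightarrow> 'b::euclidean_space" and f' :: "'a \<Rightarrow> 'a \<Rightarrow>\<^sub>L 'b"
  assumes deriv: "\<And>x. (f has_derivative blinfun_apply (f' x)) (at x)"
    and cont: "continuous_on UNIV f'"
  shows "hausdorff_content DIM('a) (f ` {x. \<not> inj (blinfun_apply (f' x))}) = 0"
proof -
  let ?m = "DIM('a)"
  let ?C = "{x. \<not> inj (blinfun_apply (f' x))}"
  define Q :: "nat \<Rightarrow> 'a set" where "Q R = cbox (- real R *\<^sub>R One) (real R *\<^sub>R One)" for R
  have Q_iff: "z \<in> Q R \<longleftrightarrow> (\<forall>b\<in>Basis. \<bar>z \<bullet> b\<bar> \<le> real R)" for z R
    by (auto simp: Q_def mem_box abs_le_iff)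
  have cube_null: "hausdorff_content ?m (f ` (?C \<inter> Q R)) = 0" if R: "0 < R" for R
  proof -
    have "compact (f' ` Q R)"
      unfolding Q_def by (intro compact_continuous_image continuous_on_subset[OF cont]) auto
    then obtain L where L: "0 < L" "\<And>x. x \<in> Q R \<Longrightarrow> norm (f' x) \<le> L"
      using compact_imp_bounded bounded_pos by (metis imageI)
    have uc: "uniformly_continuous_on (Q R) f'"
      unfolding Q_def by (intro compact_uniformly_continuous continuous_on_subset[OF cont]) auto
    \<comment> \<open>15 is 3 times 5: at most \<open>3 * R * N\<close> indices per coordinate, and
      the factor 5 of the estimate for one cell. \<open>N\<close> cancels.\<close>
    define c where "c = (15 * real R * ?m * (L + 1)) ^ ?m"
    have bound: "hausdorff_content ?m (f ` (?C \<inter> Q R)) \<le> ennreal (c / K)" if K: "0 < K" for K :: nat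
    proof -
      obtain \<delta> where \<delta>: "0 < \<delta>"
        "\<And>x y. x \<in> Q R \<Longrightarrow> y \<in> Q R \<Longrightarrow> dist y x < \<delta> \<Longrightarrow> dist (f' y) (f' x) < 1 / K"
        using uc K unfolding uniformly_continuous_on_def by (metis of_nat_0_less_iff zero_less_divide_1_iff)
      \<comment> \<open>Two points in one cell of side \<open>1 / N\<close> are at most
        \<open>?m / N\<close> apart, by comparison with the sum of the coordinates.\<close>
      obtain N :: nat where N: "0 < N" "?m / N < \<delta>"
      proof -
        obtain N :: nat where N: "?m / \<delta> < N"
          using reals_Archimedean2 by blast
        moreover have "0 < ?m / \<delta>"
          using \<delta>(1) by simp
        ultimately have "0 < real N" by linarith
        then have "0 < N" "?m / N < \<delta>"
          using \<delta>(1) N by (auto simp: field_simps)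
        then show ?thesis by (rule that)
      qed
      define I :: "('a \<Rightarrow> int) set" where "I = Basis \<rightarrow>\<^sub>E {- int (R * N)..int (R * N)}"
      define \<kappa> where "\<kappa> z = (\<lambda>b\<in>Basis. \<lfloor>N * (z \<bullet> b)\<rfloor>)" for z :: 'a
      define cell where "cell k = {z \<in> ?C \<inter> Q R. \<kappa> z = k}" for k
      have "finite I"
        unfolding I_def by (intro finite_PiE) auto
      have "\<kappa> z \<in> I" if "z \<in> Q R" for z
        unfolding \<kappa>_def I_def
      proof (rule restrict_PiE_iff[THEN iffD2], intro ballI)
        fix b :: 'a assume "b \<in> Basis"
        then have "\<bar>N * (z \<bullet> b)\<bar> \<le> N * real R"
          unfolding abs_mult using that by (intro mult_mono) (auto simp: Q_iff)
        then have "\<bar>N * (z \<bullet> b)\<bar> \<le> real (R * N)"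
          by (simp add: mult.commute)
        then show "\<lfloor>N * (z \<bullet> b)\<rfloor> \<in> {- int (R * N)..int (R * N)}"
          by (simp only: atLeastAtMost_iff le_floor_iff floor_le_iff) 
            (simp del: of_nat_mult, linarith)
      qed
      then have eq: "f ` (?C \<inter> Q R) = (\<Union>k\<in>I. f ` cell k)"
        by (auto simp: cell_def)
      have "hausdorff_content ?m (f ` (?C \<inter> Q R)) \<le> (\<Sum>k\<in>I. hausdorff_content ?m (f ` cell k))"
        by (subst eq) (rule hausdorff_content_finite_UN[OF DIM_positive \<open>finite I\<close>])
      also have "\<dots> \<le> (\<Sum>k\<in>I. ennreal ((5 * ?m * (L + 1) * (1 / N)) ^ ?m / K))"
      proof (rule sum_mono)
        fix k
        show "hausdorff_content ?m (f ` cell k) \<le> ennreal ((5 * ?m * (L + 1) * (1 / N)) ^ ?m / K)"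
        proof (cases "cell k = {}")
          case False
          then obtain x where x: "x \<in> cell k" by blast
          then have xQ: "x \<in> Q R" and xC: "\<not> inj (blinfun_apply (f' x))"
            by (auto simp: cell_def)
          have side: "\<bar>(y - z) \<bullet> b\<bar> \<le> 1 / N" if "y \<in> cell k" "z \<in> cell k" "b \<in> Basis" for y z b
          proof -
            have "\<kappa> y b = \<kappa> z b" using that by (simp add: cell_def)
            then have "\<lfloor>N * (y \<bullet> b)\<rfloor> = \<lfloor>N * (z \<bullet> b)\<rfloor>"
              using that(3) by (simp add: \<kappa>_def)
            then have "\<bar>N * (y \<bullet> b) - N * (z \<bullet> b)\<bar> \<le> 1"
              by linarith
            also have "N * (y \<bullet> b) - N * (z \<bullet> b) = N * ((y - z) \<bullet> b)"
              by (simp add: inner_diff_left algebra_simps)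
            finally show ?thesis
              using N by (simp add: abs_mult field_simps)
          qed
          \<comment> \<open>The mean value inequality requires a convex domain. The cell contains
            degenerate points only and need not be convex, so \<open>W\<close> takes its
            place.\<close>
          define W where "W = Q R \<inter> ball x \<delta>"
          have "convex W"
            by (simp add: W_def Q_def convex_Int)
          have cellW: "z \<in> W" if z: "z \<in> cell k" for z
          proof -
            have "norm (x - z) \<le> (\<Sum>b\<in>Basis. \<bar>(x - z) \<bullet> b\<bar>)"
              by (rule norm_le_l1)
            also have "\<dots> \<le> ?m * (1 / N)"
              using side[OF x z] by (rule sum_bounded_above)
            finally have "dist x z < \<delta>"
              using N(2) by (simp add: dist_norm)
            then show ?thesis using z by (simp add: W_def cell_def)
          qed
          show ?thesis
          proof (rule hausdorff_content_image_degenerate[of "blinfun_apply (f' x)"])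
            show "linear (blinfun_apply (f' x))"
              by (rule bounded_linear.linear[OF blinfun.bounded_linear_right])
            show "norm (f' x w) \<le> L * norm w" for w
              using norm_blinfun[of "f' x" w] L(2)[OF xQ]
              by (meson mult_right_mono norm_ge_zero order.trans)
            fix y z assume yz: "y \<in> cell k" "z \<in> cell k"
            have "norm ((f y - f' x y) - (f z - f' x z)) \<le> 1 / real K * norm (y - z)"
            proof (rule differentiable_bound[OF \<open>convex W\<close>])
              show "((\<lambda>y. f y - f' x y) has_derivative blinfun_apply (f' w - f' x)) (at w within W)" for w
                unfolding minus_blinfun.rep_eq
                by (intro has_derivative_diff has_derivative_at_withinI[OF deriv] 
                    bounded_linear_imp_has_derivative blinfun.bounded_linear_right)
              show "onorm (blinfun_apply (f' w - f' x)) \<le> 1 / K" if "w \<in> W" for w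
                using \<delta>(2)[OF xQ, of w] that
                by (simp add: W_def norm_blinfun.rep_eq[symmetric] dist_norm norm_minus_commute)
            qed (use yz cellW in auto)
            then show "norm (f y - f z - f' x (y - z)) \<le> norm (y - z) / K"
              by (simp add: blinfun.diff_right algebra_simps)
          qed (use xC L K N side in auto)
        qed simp
      qed
      also have "\<dots> = ennreal (card I * ((5 * ?m * (L + 1) * (1 / N)) ^ ?m / K))"
        by (subst ennreal_mult) (use L in \<open>auto simp: ennreal_of_nat_eq_real_of_nat\<close>)
      also have "\<dots> \<le> ennreal (c / K)"
      proof (rule ennreal_leI)
        have "nat (int (R * N) - - int (R * N) + 1) = 2 * (R * N) + 1"
          by (simp del: of_nat_mult)
        then have "card I = (2 * (R * N) + 1) ^ ?m"
          by (simp add: I_def card_PiE del: of_nat_mult)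
        \<comment> \<open>Absorbing the 1 requires \<open>R\<close> and \<open>N\<close> to be at
          least 1.\<close>
        also have "\<dots> \<le> (3 * R * N) ^ ?m"
          using R N by (intro power_mono) (auto simp: Suc_le_eq)
        finally have "real (card I) \<le> (3 * real R * N) ^ ?m"
          by (metis of_nat_le_iff of_nat_mult of_nat_numeral of_nat_power)
        then have "card I * ((5 * ?m * (L + 1) * (1 / N)) ^ ?m / K)
            \<le> (3 * real R * N) ^ ?m * ((5 * ?m * (L + 1) * (1 / N)) ^ ?m / K)"
          using L by (intro mult_right_mono) auto
        also have "\<dots> = (3 * real R * N * (5 * ?m * (L + 1) * (1 / N))) ^ ?m / K"
          by (subst power_mult_distrib[of "3 * real R * real N"]) (rule times_divide_eq_right)
        also have "3 * real R * N * (5 * ?m * (L + 1) * (1 / N)) = 15 * real R * ?m * (L + 1)"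
          using N by simp
        finally show "card I * ((5 * ?m * (L + 1) * (1 / N)) ^ ?m / K) \<le> c / K"
          by (simp add: c_def)
      qed
      finally show ?thesis .
    qed
    have "hausdorff_content ?m (f ` (?C \<inter> Q R)) \<le> 0"
    proof (rule ennreal_le_epsilon)
      fix e :: real assume e: "0 < e"
      obtain K :: nat where K: "\<bar>c\<bar> / e < K"
        using reals_Archimedean2 by blast
      moreover have "0 \<le> \<bar>c\<bar> / e" using e by simp
      ultimately have "0 < real K" by linarith
      then have K0: "0 < K" and cK: "c / K \<le> e"
        using e K by (auto simp: field_simps)
      show "hausdorff_content ?m (f ` (?C \<inter> Q R)) \<le> 0 + ennreal e"
        using order.trans[OF bound[OF K0] ennreal_leI[OF cK]] by simp
    qed
    then show ?thesis by simp
  qed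
  have cover: "\<exists>R. z \<in> Q (Suc R)" for z
  proof -
    obtain R :: nat where "norm z < R"
      using reals_Archimedean2 by blast
    then have "z \<in> Q (Suc R)"
      using Basis_le_norm[of _ z] by (force simp: Q_iff)
    then show ?thesis by blast
  qed
  \<comment> \<open>The index \<open>Suc R\<close> keeps the cubes nondegenerate, as
    \<open>cube_null\<close> demands.\<close>
  have "hausdorff_content ?m (\<Union>R\<in>UNIV. f ` (?C \<inter> Q (Suc R))) = 0"
    by (rule hausdorff_content_UN_null) (auto simp: cube_null)
  moreover have "f ` ?C \<subseteq> (\<Union>R\<in>UNIV. f ` (?C \<inter> Q (Suc R)))"
    using cover by blast
  ultimately show ?thesis
    by (rule hausdorff_content_null_mono)
qed

section \<open>Radial projection near a regular point\<close>

text \<open>Mean value inequality for \<open>f - f' a\<close> on a ball where \<open>f'\<close>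
  varies by less than \<open>e\<close>. Both points may move, as Lipschitz estimates
  require.\<close>

lemma strict_differentiability:
  fixes f :: "'a::euclidean_space \<Rightarrow> 'b::euclidean_space" and f' :: "'a \<Rightarrow> 'a \<Rightarrow>\<^sub>L 'b"
  assumes deriv: "\<And>x. (f has_derivative blinfun_apply (f' x)) (at x)"
    and cont: "continuous_on UNIV f'" and e: "0 < e"
  obtains r where "0 < r"
    "\<And>y z. y \<in> ball a r \<Longrightarrow> z \<in> ball a r \<Longrightarrow> norm (f y - f z - f' a (y - z)) \<le> e * norm (y - z)"
proof -
  obtain r where r: "0 < r" "\<And>w. dist w a < r \<Longrightarrow> dist (f' w) (f' a) < e"
    using cont e unfolding continuous_on_iff by (metis UNIV_I)
  have "norm (f y - f z - f' a (y - z)) \<le> e * norm (y - z)" if "y \<in> ball a r" "z \<in> ball a r" for y z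
  proof -
    have "norm ((f y - f' a y) - (f z - f' a z)) \<le> e * norm (y - z)"
    proof (rule differentiable_bound[of "ball a r"])
      show "((\<lambda>y. f y - f' a y) has_derivative blinfun_apply (f' w - f' a)) (at w within ball a r)" for w
        unfolding minus_blinfun.rep_eq
        by (intro has_derivative_diff has_derivative_at_withinI[OF deriv] 
            bounded_linear_imp_has_derivative blinfun.bounded_linear_right)
      show "onorm (blinfun_apply (f' w - f' a)) \<le> e" if "w \<in> ball a r" for w
        using r(2)[of w] that
        by (simp add: norm_blinfun.rep_eq[symmetric] dist_norm norm_minus_commute)
    qed (use that in auto)
    then show ?thesis
      by (simp add: blinfun.diff_right algebra_simps)
  qed
  with r(1) show ?thesis by (rule that)
qed

text \<open>To first order, radial projection from \<open>x\<close> forgets exactly the direction of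
  \<open>f a - x\<close>. As this direction is not tangent, a displacement \<open>y - z\<close>
  remains visible after projection. Keeping \<open>x\<close> off the image of the ball makes every
  projection there meaningful.\<close>

lemma radial_projection_local_lower_bound:
  fixes f :: "'a::euclidean_space \<Rightarrow> 'b::euclidean_space" and f' :: "'a \<Rightarrow> 'a \<Rightarrow>\<^sub>L 'b"
  assumes deriv: "\<And>x. (f has_derivative blinfun_apply (f' x)) (at x)"
    and cont: "continuous_on UNIV f'"
    and inj: "inj (blinfun_apply (f' a))"
    and x: "x - f a \<notin> range (blinfun_apply (f' a))"
  obtains r M where "0 < r" "0 \<le> M" "x \<notin> f ` ball a r"
    "\<And>y z. y \<in> ball a r \<Longrightarrow> z \<in> ball a r \<Longrightarrow>
       dist (f y) (f z) \<le> M * dist (radial_projection x (f y)) (radial_projection x (f z))"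
proof -
  define D where "D = blinfun_apply (f' a)"
  interpret D: linear D
    unfolding D_def by (rule bounded_linear.linear[OF blinfun.bounded_linear_right])
  define p where "p = f a - x"
  have p_notin: "p \<notin> range D"
  proof
    assume "p \<in> range D"
    then obtain w where "p = D w" by blast
    then have "x - f a = D (- w)"
      by (simp add: D.neg p_def) (metis minus_diff_eq)
    then show False using x by (auto simp: D_def)
  qed
  \<comment> \<open>injectivity of \<open>T\<close> says that \<open>D\<close> is injective with \<open>p\<close> outside its range; the scalar \<open>s\<close> will absorb the change of \<open>norm (f y - x)\<close>\<close>
  define T where "T = (\<lambda>(w, s). D w - s *\<^sub>R p)"
  have "linear T"
    by (rule linearI) (auto simp: T_def D.add D.scale algebra_simps)
  moreover have "inj T"
  proof (subst linear_injective_0[OF \<open>linear T\<close>], safe)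
    fix w and s :: real assume eq: "T (w, s) = 0"
    have "s = 0"
    proof (rule ccontr)
      assume "s \<noteq> 0"
      then have "p = D (w /\<^sub>R s)"
        using eq by (simp add: T_def D.scale)
      then show False using p_notin by blast
    qed
    moreover from this have "D w = D 0"
      using eq by (simp add: T_def D.zero)
    then have "w = 0"
      unfolding D_def by (rule injD[OF inj])
    ultimately show "(w, s) = 0" by (simp add: zero_prod_def)
  qed
  ultimately obtain c where c: "0 < c" "\<And>q. c * norm q \<le> norm (T q)"
    using linear_inj_bounded_below_pos by blast
  \<comment> \<open>Half of the lower bound is spent on each component, so that errors in
    \<open>w\<close> and in \<open>s\<close> can be absorbed separately.\<close>
  have T_ge: "c / 2 * norm w + c / 2 * \<bar>s\<bar> \<le> norm (D w - s *\<^sub>R p)" for w s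
  proof -
    have "c * norm w \<le> c * norm (w, s)" "c * \<bar>s\<bar> \<le> c * norm (w, s)"
      using norm_fst_le[of w s] norm_snd_le[of s w] c(1) by (auto intro!: mult_left_mono)
    then show ?thesis
      using c(2)[of "(w, s)"] by (simp add: T_def)
  qed
  have "p \<noteq> 0"
    using p_notin D.zero by (metis rangeI)
  \<comment> \<open>The bound \<open>c / 4\<close> lets \<open>p\<close> replace
    \<open>f z - x\<close> at a cost absorbed by the \<open>s\<close> term; the bound below
    \<open>norm p\<close> keeps \<open>f z\<close> away from \<open>x\<close> and gives
    \<open>norm (f y - x) \<le> 2 * norm p\<close>.\<close>
  define \<rho> where "\<rho> = min (c / 4) (norm p / 2)"
  have \<rho>: "0 < \<rho>" "\<rho> \<le> c / 4" "\<rho> < norm p"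
    using c \<open>p \<noteq> 0\<close> by (auto simp: \<rho>_def min_less_iff_disj)
  obtain r1 where r1: "0 < r1" "\<And>y z. y \<in> ball a r1 \<Longrightarrow> z \<in> ball a r1 \<Longrightarrow>
      norm (f y - f z - D (y - z)) \<le> c / 4 * norm (y - z)"
    using strict_differentiability[OF deriv cont, of "c / 4" a] c(1) unfolding D_def by auto
  have "continuous (at a) f"
    using deriv has_derivative_continuous by blast
  then obtain r2 where r2: "0 < r2" "\<And>z. dist z a < r2 \<Longrightarrow> dist (f z) (f a) < \<rho>"
    using \<rho>(1) unfolding continuous_at_eps_delta by blast
  obtain B where B: "0 < B" "\<And>w. norm (D w) \<le> norm w * B"
    using bounded_linear.pos_bounded[OF blinfun.bounded_linear_right[of "f' a"]] unfolding D_def by blast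
  define r where "r = min r1 r2"
  \<comment> \<open>The first factor is a Lipschitz constant of \<open>f\<close> on the ball; the
    second bounds \<open>norm (y - z)\<close> by the distance of the projections.\<close>
  define M where "M = (B + c / 4) * (2 * norm p / (c / 4))"
  have near: "norm ((f z - x) - p) < \<rho>" if "z \<in> ball a r" for z
    using r2(2)[of z] that by (simp add: r_def p_def dist_norm norm_minus_commute)
  have "x \<notin> f ` ball a r"
  proof
    assume "x \<in> f ` ball a r"
    then obtain z where "z \<in> ball a r" "f z = x" by blast
    then have "norm p < \<rho>" using near[of z] by simp
    then show False using \<rho>(3) by simp
  qed
  moreover have "dist (f y) (f z) \<le> M * dist (radial_projection x (f y)) (radial_projection x (f z))"
    if y: "y \<in> ball a r" and z: "z \<in> ball a r" for y z
  proof -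
    define u where "u = f y - x"
    define v where "v = f z - x"
    have ne: "u \<noteq> 0" "v \<noteq> 0"
      using \<open>x \<notin> f ` ball a r\<close> y z by (auto simp: u_def v_def)
    \<comment> \<open>With this \<open>s\<close>, \<open>v + s *\<^sub>R v\<close> is
      \<open>v\<close> rescaled to the length of \<open>u\<close>, so
      \<open>u - v - s *\<^sub>R v\<close> is \<open>norm u\<close> times the difference of the
      projections.\<close>
    define s where "s = norm u / norm v - 1"
    define R where "R = dist (radial_projection x (f y)) (radial_projection x (f z))"
    have "f y - f z - D (y - z) = u - v - D (y - z)"
      by (simp add: u_def v_def)
    then have approx: "norm (u - v - D (y - z)) \<le> c / 4 * norm (y - z)"
      using r1(2)[of y z] y z by (simp add: r_def)
    have "norm (s *\<^sub>R (v - p)) \<le> \<bar>s\<bar> * (c / 4)"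
      using near[OF z] \<rho>(2) unfolding norm_scaleR v_def by (intro mult_left_mono) auto
    moreover have split: "D (y - z) - s *\<^sub>R p = (u - v - s *\<^sub>R v) - (u - v - D (y - z)) + s *\<^sub>R (v - p)"
      by (simp add: algebra_simps)
    have "norm (D (y - z) - s *\<^sub>R p)
        \<le> norm (u - v - s *\<^sub>R v) + norm (u - v - D (y - z)) + norm (s *\<^sub>R (v - p))"
      unfolding split by (meson add_right_mono norm_triangle_ineq norm_triangle_ineq4 order.trans)
    moreover note T_ge[of "y - z" s] approx
    ultimately have "c / 2 * norm (y - z) + c / 2 * \<bar>s\<bar>
        \<le> norm (u - v - s *\<^sub>R v) + c / 4 * norm (y - z) + \<bar>s\<bar> * (c / 4)"
      by linarith
    moreover have "0 \<le> c * \<bar>s\<bar>" using c by simp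
    ultimately have "c / 4 * norm (y - z) \<le> norm (u - v - s *\<^sub>R v)"
      by (simp add: algebra_simps)
    also have "u - v - s *\<^sub>R v = norm u *\<^sub>R (radial_projection x (f y) - radial_projection x (f z))"
      using ne by (simp add: radial_projection_def u_def[symmetric] v_def[symmetric] s_def algebra_simps
          divide_inverse)
    also have "norm \<dots> = norm u * R"
      by (simp add: R_def dist_norm)
    also have "\<dots> \<le> 2 * norm p * R"
    proof (rule mult_right_mono)
      have "norm u \<le> norm p + norm (u - p)"
        by (metis add.commute diff_add_cancel norm_triangle_ineq)
      then show "norm u \<le> 2 * norm p"
        using near[OF y] \<rho>(3) by (simp add: u_def)
    qed (simp add: R_def)
    finally have yz: "norm (y - z) \<le> 2 * norm p / (c / 4) * R"
      using c(1) by (simp add: field_simps)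
    have "dist (f y) (f z) = norm ((u - v - D (y - z)) + D (y - z))"
      by (simp add: dist_norm u_def v_def)
    also have "\<dots> \<le> c / 4 * norm (y - z) + norm (y - z) * B"
      using approx B(2) by (meson add_mono norm_triangle_le)
    also have "\<dots> = (B + c / 4) * norm (y - z)"
      by (simp add: algebra_simps)
    also have "\<dots> \<le> (B + c / 4) * (2 * norm p / (c / 4) * R)"
      using B(1) c(1) yz by (intro mult_left_mono) auto
    finally show ?thesis
      by (simp add: M_def R_def mult.assoc)
  qed
  moreover have "0 < r" "0 \<le> M"
    using r1 r2 B c by (auto simp: r_def M_def)
  ultimately show ?thesis using that by blast
qed

section \<open>Localisation at a regular point and choice of the centre\<close>

lemma nonnull_image_regular_point:
  fixes f :: "'a::euclidean_space \<Rightarrow> 'b::euclidean_space" and f' :: "'a \<Rightarrow> 'a \<Rightarrow>\<^sub>L 'b"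
  assumes deriv: "\<And>x. (f has_derivative blinfun_apply (f' x)) (at x)"
    and cont: "continuous_on UNIV f'"
    and nonnull: "hausdorff_content DIM('a) (f ` A) \<noteq> 0"
  shows "\<exists>a. inj (blinfun_apply (f' a)) \<and>
    (\<forall>r>0. hausdorff_content DIM('a) (f ` (A \<inter> ball a r)) \<noteq> 0)"
proof (rule ccontr)
  let ?null = "\<lambda>S. hausdorff_content DIM('a) (f ` S) = 0"
  let ?C = "{x. \<not> inj (blinfun_apply (f' x))}"
  assume "\<not> ?thesis"
  then have bad: "\<exists>r>0. ?null (A \<inter> ball a r)" if "a \<notin> ?C" for a
    using that by blast
  define F where "F = {U. open U \<and> ?null (A \<inter> U)}"
  obtain F' where F': "F' \<subseteq> F" "countable F'" "\<Union>F' = \<Union>F"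
    by (rule Lindelof[of F]) (auto simp: F_def)
  have "hausdorff_content DIM('a) (\<Union>U\<in>F'. f ` (A \<inter> U)) = 0"
    by (rule hausdorff_content_UN_null[OF DIM_positive F'(2)]) (use F'(1) in \<open>auto simp: F_def\<close>)
  moreover have "?null ?C"
    by (rule hausdorff_content_degenerate_values_null[OF deriv cont])
  ultimately have "hausdorff_content DIM('a) ((\<Union>U\<in>F'. f ` (A \<inter> U)) \<union> f ` ?C) = 0"
    using hausdorff_content_Un[OF DIM_positive] by (metis add_0 le_zero_eq)
  moreover have "a \<in> ?C \<union> \<Union>F'" for a
  proof (cases "a \<in> ?C")
    case False
    then obtain r where "r > 0" "?null (A \<inter> ball a r)" using bad by blast
    then have "a \<in> \<Union>F" by (force simp: F_def)
    then show ?thesis using F' by simp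
  qed simp
  then have "f ` A \<subseteq> (\<Union>U\<in>F'. f ` (A \<inter> U)) \<union> f ` ?C"
    by blast
  ultimately show False
    using nonnull hausdorff_content_null_mono by blast
qed

lemma rectifiable_nonnull_radial_projection:
  fixes E :: "'b::euclidean_space set"
  assumes rect: "rectifiable TYPE('a::euclidean_space) E" and not_flat: "\<not> flat DIM('a) E"
  obtains x where "x \<in> E" "0 < hausdorff_measure DIM('a) (radial_projection x ` (E - {x}))"
proof -
  let ?m = "DIM('a)"
  note null_iff = hausdorff_measure_eq_0_iff[OF DIM_positive[where 'a='a]]
  obtain F :: "('a \<Rightarrow> 'b) set" where pos: "0 < hausdorff_measure ?m E"
    and F: "countable F" "\<And>f. f \<in> F \<Longrightarrow> C1_embedding f"
    and rest: "hausdorff_measure ?m (E - (\<Union>f\<in>F. range f)) = 0"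
    using rect unfolding rectifiable_def by blast
  \<comment> \<open>\<open>E\<close> is the union of countably many pieces and a null set, so some
    piece is not null.\<close>
  obtain f where f: "f \<in> F" "hausdorff_content ?m (E \<inter> range f) \<noteq> 0"
  proof (rule ccontr)
    assume "\<not> thesis"
    then have "hausdorff_content ?m (\<Union>f\<in>F. E \<inter> range f) = 0"
      using that by (intro hausdorff_content_UN_null F DIM_positive) blast
    then have "hausdorff_content ?m ((\<Union>f\<in>F. E \<inter> range f) \<union> (E - (\<Union>f\<in>F. range f))) = 0"
      using rest hausdorff_content_Un[OF DIM_positive] null_iff by (metis add_0 le_zero_eq)
    then have "hausdorff_content ?m E = 0"
      by (rule hausdorff_content_null_mono) blast
    then show False using pos null_iff[of E] by (simp add: zero_less_iff_neq_zero)
  qed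
  obtain f' :: "'a \<Rightarrow> 'a \<Rightarrow>\<^sub>L 'b" where f': "\<And>x. (f has_derivative blinfun_apply (f' x)) (at x)"
    "continuous_on UNIV f'"
    using F(2)[OF f(1)] unfolding C1_embedding_def by blast
  define A where "A = f -` E"
  have "f ` A = E \<inter> range f"
    by (auto simp: A_def)
  then obtain a where a: "inj (blinfun_apply (f' a))"
    "\<And>r. 0 < r \<Longrightarrow> hausdorff_content ?m (f ` (A \<inter> ball a r)) \<noteq> 0"
    using nonnull_image_regular_point[OF f', of A] f(2) by metis
  \<comment> \<open>The tangent plane at \<open>f a\<close>. Injectivity of the derivative gives it
    dimension exactly \<open>?m\<close>, so non-flatness applies to it.\<close>
  define T where "T = (+) (f a) ` range (blinfun_apply (f' a))"
  have lin: "linear (blinfun_apply (f' a))"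
    by (rule bounded_linear.linear[OF blinfun.bounded_linear_right])
  have sub: "subspace (range (blinfun_apply (f' a)))"
    by (rule linear_subspace_image[OF lin subspace_UNIV])
  have "affine T"
    unfolding T_def by (simp add: affine_translation[symmetric] subspace_imp_affine sub)
  moreover have "aff_dim T = int ?m"
    using sub a(1) dim_image_eq[OF lin, of UNIV]
    by (simp add: T_def aff_dim_translation_eq aff_dim_subspace dim_UNIV)
  ultimately obtain x where x: "x \<in> E" "x \<notin> T"
    using not_flat unfolding flat_def by blast
  then have "x - f a \<notin> range (blinfun_apply (f' a))"
    unfolding T_def by (metis add.commute diff_add_cancel image_eqI)
  then obtain r M where r: "0 < r" "0 \<le> M" "x \<notin> f ` ball a r"
    "\<And>y z. y \<in> ball a r \<Longrightarrow> z \<in> ball a r \<Longrightarrow>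
       dist (f y) (f z) \<le> M * dist (radial_projection x (f y)) (radial_projection x (f z))"
    using radial_projection_local_lower_bound[OF f' a(1)] by metis
  have "hausdorff_content ?m (radial_projection x ` (E - {x})) \<noteq> 0"
  proof
    assume "hausdorff_content ?m (radial_projection x ` (E - {x})) = 0"
    then have "hausdorff_content ?m ((\<lambda>z. radial_projection x (f z)) ` (A \<inter> ball a r)) = 0"
      by (rule hausdorff_content_null_mono) (use r(3) in \<open>auto simp: A_def\<close>)
    then have "hausdorff_content ?m (f ` (A \<inter> ball a r)) = 0"
      by (intro hausdorff_content_null_dominated_image[OF DIM_positive r(2) r(4)]) auto
    then show False using a(2)[OF r(1)] by simp
  qed
  then show ?thesis
    using that x(1) null_iff by (metis not_gr_zero)
qed

theorem mainTheorem2: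
  fixes E :: "(real ^ 'n) set"
  assumes "CARD('m::finite) < CARD('n::finite)"
    and "rectifiable TYPE(real ^ 'm) E"
    and "\<not> flat CARD('m) E"
  shows "(\<exists>x\<in>E. hausdorff_measure CARD('m) (radial_projection x ` (E - {x})) > 0) \<and>
         hausdorff_measure CARD('m) (directions E) > 0"
proof -
  obtain x where x: "x \<in> E" "0 < hausdorff_measure CARD('m) (radial_projection x ` (E - {x}))"
    using rectifiable_nonnull_radial_projection[OF assms(2)] assms(3) by auto
  have "radial_projection x ` (E - {x}) \<subseteq> directions E"
    using x(1) by (auto simp: directions_def radial_projection_def)
  moreover have "0 < CARD('m)" by simp
  \<comment> \<open>Monotonicity passes through the content, which has the same null sets.\<close>
  ultimately have "hausdorff_measure CARD('m) (directions E) \<noteq> 0"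
    using x(2) hausdorff_measure_eq_0_iff hausdorff_content_null_mono by (metis less_irrefl)
  with x show ?thesis by (auto simp: zero_less_iff_neq_zero)
qed

end
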